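(* Let $\mathfrak{A}$ be a residuated lattice. The following assertions are equivalent: (1) $\mathfrak{A}$ is weakly disjunctive; (2) any filter of $\mathfrak{A}$ is an $\alpha$-filter; (3) any prime filter of $\mathfrak{A}$ is an $\alpha$-filter.
   Context: A residuated lattice $\mathfrak{A}=(A;\vee,\wedge,\odot,\rightarrow,0,1)$ is an algebra such that $(A;\vee,\wedge,0,1)$ is a bounded lattice, $(A;\odot,1)$ is a commutative monoid, and $x\odot y\leq z$ iff $x\leq y\rightarrow z$. A filter is a non-empty $F\subseteq A$ closed under $\odot$ and such that $x\in F$, $y\in A$ imply $x\vee y\in F$; it is proper if $F\neq A$. A prime filter is a proper filter $P$ such that $x\vee y\in P$ implies $x\in P$ or $y\in P$. $\mathscr{F}(x)$ is the filter generated by $x$. For $X\subseteq A$, $X^{\perp}=\{a\in A\mid a\vee x=1\ \forall x\in X\}$; $x^{\perp}:=\{x\}^{\perp}$ and $x^{\perp\perp}:=(x^{\perp})^{\perp}$. A filter $F$ is an $\alpha$-filter if $x^{\perp\perp}\subseteq F$ for every $x\in F$. $\mathfrak{A}$ is weakly disjunctive if the (well-defined) map $\mathscr{F}(x)\mapsto x^{\perp}$ on principal filters is injective, i.e. $x^{\perp}=y^{\perp}$ implies $\mathscr{F}(x)=\mathscr{F}(y)$. *)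

theory Defs
  imports Main "HOL.Hull"
begin

text \<open>
  The lattice operations and constants are \<^const>\<open>sup\<close>, \<^const>\<open>inf\<close>, \<^const>\<open>bot\<close> and
  \<^const>\<open>top\<close>; the monoid is written multiplicatively. The unit of the monoid is required to be
  the top element, so \<^term>\<open>1\<close> and \<^const>\<open>top\<close> both denote the constant \<open>1\<close> of the algebra,
  and its \<open>0\<close> is \<^const>\<open>bot\<close>. The one-element algebra is allowed.
\<close>

class residuated_lattice = bounded_lattice + comm_monoid_mult +
  fixes residuum :: "'a \<Rightarrow> 'a \<Rightarrow> 'a"  (infixr "\<rightarrow>\<^sub>r" 60)
  assumes one_eq_top: "1 = top"
    and residuation: "x * y \<le> z \<longleftrightarrow> x \<le> y \<rightarrow>\<^sub>r z"

definition rl_filter :: "'a::residuated_lattice set \<Rightarrow> bool" where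
  "rl_filter F \<longleftrightarrow>
     F \<noteq> {} \<and> (\<forall>x\<in>F. \<forall>y\<in>F. x * y \<in> F) \<and> (\<forall>x\<in>F. \<forall>y. sup x y \<in> F)"

definition prime_filter :: "'a::residuated_lattice set \<Rightarrow> bool" where
  "prime_filter P \<longleftrightarrow>
     rl_filter P \<and> P \<noteq> UNIV \<and> (\<forall>x y. sup x y \<in> P \<longrightarrow> x \<in> P \<or> y \<in> P)"

definition principal_filter :: "'a::residuated_lattice \<Rightarrow> 'a set" where
  "principal_filter x = rl_filter hull {x}"

definition perp :: "'a::residuated_lattice set \<Rightarrow> 'a set" where
  "perp X = {a. \<forall>x\<in>X. sup a x = 1}"

definition alpha_filter :: "'a::residuated_lattice set \<Rightarrow> bool" where
  "alpha_filter F \<longleftrightarrow> rl_filter F \<and> (\<forall>x\<in>F. perp (perp {x}) \<subseteq> F)"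

text \<open>
  Injectivity of the map sending the principal filter of \<open>x\<close> to \<open>perp {x}\<close>. It is a property of
  the whole algebra, hence the type argument.
\<close>

definition weakly_disjunctive :: "'a::residuated_lattice itself \<Rightarrow> bool" where
  "weakly_disjunctive (A :: 'a itself) \<longleftrightarrow>
     (\<forall>x y :: 'a. perp {x} = perp {y} \<longrightarrow> principal_filter x = principal_filter y)"

end

theory Submission
  imports Defs
begin

text \<open>
  Since the perp of \<open>x * y\<close> is the intersection of those of \<open>x\<close> and \<open>y\<close>, an element \<open>y\<close> of the
  double perp of \<open>x\<close> satisfies \<open>perp {x * y} = perp {x}\<close>; weak disjunctiveness then puts
  \<open>x * y\<close>, and so \<open>y\<close>, into every filter containing \<open>x\<close>. Conversely, \<open>x\<close> always lies in its own
  double perp. Prime filters suffice because every filter is an intersection of prime filters: a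
  filter \<open>P\<close> maximal among those avoiding \<open>y\<close> is prime, as one sees by comparing it with the
  larger filters \<open>{c. sup c b \<in> P}\<close>.
\<close>

context residuated_lattice
begin

lemma mult_right_mono_rl: "a \<le> b \<Longrightarrow> a * c \<le> b * c"
  by (meson order_refl order_trans residuation)

lemma mult_left_mono_rl: "a \<le> b \<Longrightarrow> c * a \<le> c * b"
  by (metis mult_right_mono_rl mult.commute)

lemma le_one: "x \<le> 1"
  by (simp add: one_eq_top)

lemma mult_le_left: "x * y \<le> x"
  using mult_left_mono_rl[OF le_one, of x y] by simp

lemma mult_le_right: "x * y \<le> y"
  by (metis mult_le_left mult.commute)

text \<open>By residuation both sides bound \<open>x\<close> and \<open>y\<close> by
  \<open>z \<rightarrow>\<^sub>r w\<close>. This is distributivity of the product over joins, stated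
  through upper bounds.\<close>

lemma sup_mult_le: "sup x y * z \<le> w \<longleftrightarrow> x * z \<le> w \<and> y * z \<le> w"
  by (simp add: residuation)

text \<open>Expanding the product by distributivity, every term other than \<open>x * y\<close> has
  a factor \<open>a\<close> and so lies below \<open>a\<close>.\<close>

lemma sup_mult_sup_le: "sup a x * sup a y \<le> sup a (x * y)"
proof -
  have "a * sup a y \<le> sup a (x * y)"
    using mult_le_left by (rule le_supI1)
  moreover have "x * sup a y \<le> sup a (x * y)"
  proof -
    \<comment> \<open>The factors are swapped because \<open>sup_mult_le\<close> expands a join in
      the left factor.\<close>
    have "sup a y * x \<le> sup a (x * y)"
      unfolding sup_mult_le using mult_le_left by (simp add: mult.commute le_supI1)
    then show ?thesis
      by (simp add: mult.commute)
  qed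
  ultimately show ?thesis
    by (simp add: sup_mult_le)
qed

end

lemma rl_filter_mult: "rl_filter F \<Longrightarrow> x \<in> F \<Longrightarrow> y \<in> F \<Longrightarrow> x * y \<in> F"
  unfolding rl_filter_def by blast

lemma rl_filter_mono: "rl_filter F \<Longrightarrow> x \<in> F \<Longrightarrow> x \<le> y \<Longrightarrow> y \<in> F"
  unfolding rl_filter_def by (metis sup.absorb2)

lemma rl_filter_one: "rl_filter F \<Longrightarrow> 1 \<in> F"
  using rl_filter_mono le_one unfolding rl_filter_def by blast

lemma rl_filterI:
  assumes "1 \<in> F" "\<And>x y. x \<in> F \<Longrightarrow> y \<in> F \<Longrightarrow> x * y \<in> F" "\<And>x y. x \<in> F \<Longrightarrow> x \<le> y \<Longrightarrow> y \<in> F"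
  shows "rl_filter F"
  unfolding rl_filter_def using assms by (metis empty_iff sup.cobounded1)

lemma rl_filter_Inter:
  assumes "\<And>F. F \<in> \<F> \<Longrightarrow> rl_filter F"
  shows "rl_filter (\<Inter>\<F>)"
  by (rule rl_filterI) (use assms rl_filter_one rl_filter_mult rl_filter_mono in blast)+

text \<open>Provides the upper bounds for Zorn's lemma: of two members containing \<open>x\<close>
  and \<open>y\<close>, the larger contains both.\<close>

lemma rl_filter_Union_chain:
  assumes ne: "\<C> \<noteq> {}" and chain: "subset.chain {F. rl_filter F} \<C>"
  shows "rl_filter (\<Union>\<C>)"
proof (rule rl_filterI)
  have filt: "rl_filter F" if "F \<in> \<C>" for F
    using chain that unfolding subset.chain_def by blast
  show "1 \<in> \<Union>\<C>"
    using ne filt rl_filter_one by blast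
  show "y \<in> \<Union>\<C>" if "x \<in> \<Union>\<C>" "x \<le> y" for x y
    using that filt rl_filter_mono by blast
  show "x * y \<in> \<Union>\<C>" if xy: "x \<in> \<Union>\<C>" "y \<in> \<Union>\<C>" for x y
  proof -
    obtain F G where FG: "F \<in> \<C>" "x \<in> F" "G \<in> \<C>" "y \<in> G"
      using xy by blast
    then have "F \<subseteq> G \<or> G \<subseteq> F"
      using chain unfolding subset_chain_def by blast
    then show ?thesis
      using FG filt rl_filter_mult by blast
  qed
qed

text \<open>Closure under products is \<open>sup_mult_sup_le\<close>: the product of
  \<open>sup x b\<close> and \<open>sup y b\<close> is in \<open>F\<close> and lies below
  \<open>sup (x * y) b\<close>.\<close>

lemma rl_filter_residual:
  assumes F: "rl_filter F"
  shows "rl_filter {c. sup c b \<in> F}"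
proof (rule rl_filterI)
  show "1 \<in> {c. sup c b \<in> F}"
    using rl_filter_mono[OF F rl_filter_one[OF F]] by simp
  show "y \<in> {c. sup c b \<in> F}" if "x \<in> {c. sup c b \<in> F}" "x \<le> y" for x y
    using that rl_filter_mono[OF F] sup_mono by blast
  show "x * y \<in> {c. sup c b \<in> F}" if "x \<in> {c. sup c b \<in> F}" "y \<in> {c. sup c b \<in> F}" for x y
    using that rl_filter_mono[OF F rl_filter_mult[OF F] sup_mult_sup_le[of b x y]]
    by (simp add: sup_commute)
qed

lemma rl_filter_principal_filter: "rl_filter (principal_filter x)"
  unfolding principal_filter_def hull_def by (rule rl_filter_Inter) blast

lemma mem_principal_filter: "x \<in> principal_filter x"
  unfolding principal_filter_def by (simp add: hull_inc)

lemma principal_filter_subset: "rl_filter F \<Longrightarrow> x \<in> F \<Longrightarrow> principal_filter x \<subseteq> F"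
  unfolding principal_filter_def by (rule hull_minimal) auto

lemma maximal_avoiding_is_prime:
  assumes P: "rl_filter P" and y: "y \<notin> P"
    and max: "\<And>G. rl_filter G \<Longrightarrow> P \<subseteq> G \<Longrightarrow> y \<notin> G \<Longrightarrow> G = P"
  shows "prime_filter P"
proof -
  have step: "sup y b \<in> P" if ab: "sup a b \<in> P" and a: "a \<notin> P" for a b
  proof (rule ccontr)
    assume "sup y b \<notin> P"
    moreover have "P \<subseteq> {c. sup c b \<in> P}"
      using rl_filter_mono[OF P] sup.cobounded1 by blast
    \<comment> \<open>The assumption says that this larger filter still avoids \<open>y\<close>, so
      maximality collapses it to \<open>P\<close>, although it contains \<open>a\<close>.\<close>
    ultimately have "{c. sup c b \<in> P} = P"
      using max[OF rl_filter_residual[OF P]] by blast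
    then show False
      using ab a by blast
  qed
  have "a \<in> P \<or> b \<in> P" if ab: "sup a b \<in> P" for a b
    \<comment> \<open>If neither \<open>a\<close> nor \<open>b\<close> were in \<open>P\<close>,
      \<open>step\<close> would replace first \<open>a\<close> and then \<open>b\<close> by
      \<open>y\<close>, giving \<open>sup y y = y\<close> in \<open>P\<close>.\<close>
    using step[OF ab] step[of b y] y by (auto simp: sup_commute)
  then show ?thesis
    using P y unfolding prime_filter_def by blast
qed

lemma prime_filter_separation:
  assumes F: "rl_filter F" and y: "y \<notin> F"
  obtains P where "prime_filter P" "F \<subseteq> P" "y \<notin> P"
proof -
  let ?S = "{G. rl_filter G \<and> F \<subseteq> G \<and> y \<notin> G}"
  have "\<Union>\<C> \<in> ?S" if ne: "\<C> \<noteq> {}" and chain: "subset.chain ?S \<C>" for \<C>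
  proof -
    have "subset.chain {F. rl_filter F} \<C>"
      using chain unfolding subset_chain_def by blast
    then show ?thesis
      using rl_filter_Union_chain[OF ne] ne chain unfolding subset_chain_def by blast
  qed
  moreover have "?S \<noteq> {}"
    using F y by blast
  ultimately have "\<exists>P\<in>?S. \<forall>G\<in>?S. P \<subseteq> G \<longrightarrow> G = P"
    by (intro subset_Zorn_nonempty)
  then obtain P where P: "P \<in> ?S" and max: "\<forall>G\<in>?S. P \<subseteq> G \<longrightarrow> G = P"
    by blast
  have "prime_filter P"
    by (rule maximal_avoiding_is_prime[of P y]) (use P max in blast)+
  then show thesis
    using P that by blast
qed

lemma subset_perp_perp: "X \<subseteq> perp (perp X)"
  unfolding perp_def by (auto simp: sup_commute)

text \<open>One inclusion is monotonicity of joins; for the other, \<open>sup_mult_sup_le\<close>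
  gives \<open>1 * 1 \<le> sup a (x * y)\<close>.\<close>

lemma perp_mult: "perp {x * y} = perp {x} \<inter> perp {y}"
proof -
  have "sup a (x * y) = 1 \<longleftrightarrow> sup a x = 1 \<and> sup a y = 1" for a
  proof
    have "sup a (x * y) \<le> sup a x" "sup a (x * y) \<le> sup a y"
      by (simp_all add: le_supI2 mult_le_left mult_le_right)
    then show "sup a x = 1 \<and> sup a y = 1" if "sup a (x * y) = 1"
      using that by (simp add: antisym le_one)
    show "sup a (x * y) = 1" if "sup a x = 1 \<and> sup a y = 1"
      using that sup_mult_sup_le[of a x y] by (simp add: antisym le_one)
  qed
  then show ?thesis
    unfolding perp_def by auto
qed

lemma perp_subset_of_mem_perp_perp: "y \<in> perp (perp {x}) \<Longrightarrow> perp {x} \<subseteq> perp {y}"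
  unfolding perp_def by (auto simp: sup_commute)

lemma weakly_disjunctive_imp_alpha_filter:
  fixes F :: "'a::residuated_lattice set"
  assumes wd: "weakly_disjunctive TYPE('a)" and F: "rl_filter F"
  shows "alpha_filter F"
proof -
  have "y \<in> F" if x: "x \<in> F" and y: "y \<in> perp (perp {x})" for x y
  proof -
    have "perp {x * y} = perp {x}"
      using perp_mult perp_subset_of_mem_perp_perp[OF y] by blast
    then have "principal_filter (x * y) = principal_filter x"
      using wd unfolding weakly_disjunctive_def by blast
    then have "x * y \<in> F"
      using mem_principal_filter principal_filter_subset[OF F x] by blast
    then show ?thesis
      using rl_filter_mono[OF F] mult_le_right by blast
  qed
  then show ?thesis
    using F unfolding alpha_filter_def by blast
qed

lemma weakly_disjunctiveI:
  assumes alpha: "\<And>F :: 'a::residuated_lattice set. rl_filter F \<Longrightarrow> alpha_filter F"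
  shows "weakly_disjunctive TYPE('a)"
proof -
  \<comment> \<open>One inclusion suffices, since the hypothesis is symmetric in \<open>x\<close>
    and \<open>y\<close>. It comes from the alpha property of
    \<open>principal_filter y\<close>.\<close>
  have "principal_filter x \<subseteq> principal_filter y" if eq: "perp {x} = perp {y}" for x y :: 'a
  proof (rule principal_filter_subset[OF rl_filter_principal_filter])
    have "x \<in> perp (perp {y})"
      using subset_perp_perp[of "{x}"] eq by simp
    then show "x \<in> principal_filter y"
      using alpha[OF rl_filter_principal_filter] mem_principal_filter
      unfolding alpha_filter_def by blast
  qed
  then show ?thesis
    unfolding weakly_disjunctive_def by blast
qed

lemma alpha_filter_if_prime_filters_alpha:
  fixes F :: "'a::residuated_lattice set"
  assumes prime: "\<And>P :: 'a set. prime_filter P \<Longrightarrow> alpha_filter P" and F: "rl_filter F"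
  shows "alpha_filter F"
proof -
  have "y \<in> F" if x: "x \<in> F" and y: "y \<in> perp (perp {x})" for x y
  proof (rule ccontr)
    assume "y \<notin> F"
    then obtain P where "prime_filter P" "F \<subseteq> P" "y \<notin> P"
      using prime_filter_separation[OF F] by blast
    \<comment> \<open>\<open>P\<close> contains \<open>x\<close>, so its alpha property forces
      \<open>y\<close> into \<open>P\<close>.\<close>
    then show False
      using prime x y unfolding alpha_filter_def by blast
  qed
  then show ?thesis
    using F unfolding alpha_filter_def by blast
qed

theorem proposition5p9:
  shows "(weakly_disjunctive TYPE('a::residuated_lattice) \<longleftrightarrow>
            (\<forall>F :: 'a set. rl_filter F \<longrightarrow> alpha_filter F)) \<and>
         ((\<forall>F :: 'a set. rl_filter F \<longrightarrow> alpha_filter F) \<longleftrightarrow>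
            (\<forall>P :: 'a set. prime_filter P \<longrightarrow> alpha_filter P))"
proof (intro conjI iffI allI impI)
  show "alpha_filter F" if "weakly_disjunctive TYPE('a)" "rl_filter F" for F :: "'a set"
    using that by (rule weakly_disjunctive_imp_alpha_filter)
  show "weakly_disjunctive TYPE('a)" if "\<forall>F :: 'a set. rl_filter F \<longrightarrow> alpha_filter F"
    by (rule weakly_disjunctiveI) (use that in blast)
  show "alpha_filter P" if "\<forall>F :: 'a set. rl_filter F \<longrightarrow> alpha_filter F" "prime_filter P"
    for P :: "'a set"
    using that unfolding prime_filter_def by blast
  show "alpha_filter F" if "\<forall>P :: 'a set. prime_filter P \<longrightarrow> alpha_filter P" "rl_filter F"
    for F :: "'a set"
    by (rule alpha_filter_if_prime_filters_alpha) (use that in blast)+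
qed

end
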